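(* Let $p\in\mathbb{N}$, $p\ge2$, and let $I\subset(0,\infty)$ be an interval. Then there exists exactly one mean $M\colon I^p\to I$ such that $$G\circ\big(A,\underbrace{M,\dots,M}_{(p-1)\text{ times}}\big)=G \quad\text{on } I^p.$$ Furthermore, $M=\mathcal{B}_p$ (restricted to $I^p$).
   Context: A function $M\colon I^p\to I$ is a mean if $\min(x_1,\dots,x_p)\le M(x_1,\dots,x_p)\le\max(x_1,\dots,x_p)$ for all $x_1,\dots,x_p\in I$. $A$ and $G$ denote the $p$-variable arithmetic and geometric means, $A(x)=\frac{x_1+\dots+x_p}{p}$, $G(x)=(x_1\cdots x_p)^{1/p}$. The $p$-variable Beta-type mean is $$\mathcal{B}_p(x_1,\dots,x_p):=\left(\frac{p\,x_1\cdots x_p}{x_1+\dots+x_p}\right)^{\frac1{p-1}},\qquad x_1,\dots,x_p>0.$$ *)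

theory Defs
  imports "HOL-Analysis.Analysis"
begin

text \<open>
  A point of \<open>I\<^sup>p\<close> is a function on the index set \<open>{..<p}\<close>, extended by \<open>undefined\<close>;
  the coordinate \<open>x\<^sub>k\<close> is \<open>x (k - 1)\<close>.
\<close>

definition cart_power :: "real set \<Rightarrow> nat \<Rightarrow> (nat \<Rightarrow> real) set" where
  "cart_power I p = {..<p} \<rightarrow>\<^sub>E I"

text \<open>
  Maps \<open>I\<^sup>p \<rightarrow> I\<close> are likewise taken to be extensional, so that equality of such maps in
  HOL is equality on \<open>I\<^sup>p\<close>.
\<close>

definition is_mean :: "nat \<Rightarrow> real set \<Rightarrow> ((nat \<Rightarrow> real) \<Rightarrow> real) \<Rightarrow> bool" where
  "is_mean p I M \<longleftrightarrow>
     M \<in> cart_power I p \<rightarrow>\<^sub>E I \<and>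
     (\<forall>x \<in> cart_power I p. Min (x ` {..<p}) \<le> M x \<and> M x \<le> Max (x ` {..<p}))"

definition arith_mean :: "nat \<Rightarrow> (nat \<Rightarrow> real) \<Rightarrow> real" where
  "arith_mean p x = (\<Sum>i<p. x i) / real p"

definition geom_mean :: "nat \<Rightarrow> (nat \<Rightarrow> real) \<Rightarrow> real" where
  "geom_mean p x = (\<Prod>i<p. x i) powr (1 / real p)"

definition beta_mean :: "nat \<Rightarrow> (nat \<Rightarrow> real) \<Rightarrow> real" where
  "beta_mean p x = (real p * (\<Prod>i<p. x i) / (\<Sum>i<p. x i)) powr (1 / (real p - 1))"

text \<open>The map \<open>F \<circ> (K, M, \<dots>, M)\<close>, with \<open>M\<close> occurring \<open>p - 1\<close> times.\<close>

definition comp_one_rest ::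
  "nat \<Rightarrow> ((nat \<Rightarrow> real) \<Rightarrow> real) \<Rightarrow> ((nat \<Rightarrow> real) \<Rightarrow> real) \<Rightarrow> ((nat \<Rightarrow> real) \<Rightarrow> real)
     \<Rightarrow> (nat \<Rightarrow> real) \<Rightarrow> real" where
  "comp_one_rest p F K M x = F (\<lambda>i\<in>{..<p}. if i = 0 then K x else M x)"

end

theory Submission
  imports Defs
begin

text \<open>
  The product of the \<open>p\<close> arguments of \<open>G \<circ> (A, M, \<dots>, M)\<close> is \<open>A \<cdot> M\<^bsup>p-1\<^esup>\<close>. Positive numbers with
  equal \<open>p\<close>-th roots are equal, so the invariance equation at a point \<open>x\<close> with positive
  coordinates says \<open>A(x) \<cdot> M(x)\<^bsup>p-1\<^esup> = x\<^sub>1 \<cdots> x\<^sub>p\<close>. Solved for the positive number \<open>M(x)\<close>, this is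
  exactly the formula defining the Beta-type mean (\<open>invariance_iff_beta_mean\<close>). A mean on \<open>I\<close> takes
  its values in \<open>I\<close> and is therefore positive, so uniqueness and the formula for \<open>M\<close> follow
  point by point.

  What remains for existence is that the Beta-type mean lies between the least and the greatest
  coordinate, and so in \<open>I\<close>. Since its \<open>(p-1)\<close>-st power is \<open>p x\<^sub>1 \<cdots> x\<^sub>p / (x\<^sub>1 + \<dots> + x\<^sub>p)\<close>, this
  amounts to comparing \<open>p x\<^sub>1 \<cdots> x\<^sub>p\<close> with \<open>c\<^bsup>p-1\<^esup> (x\<^sub>1 + \<dots> + x\<^sub>p)\<close> for the two extreme values \<open>c\<close>
  (\<open>power_mult_sum_le_card_mult_prod\<close> and its counterpart).
\<close>

text \<open>
  For each single \<open>i \<in> S\<close>, bounding every factor of the product except \<open>x i\<close> gives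
  \<open>a\<^bsup>n-1\<^esup> \<cdot> x i \<le> \<Prod>x\<close>; these \<open>n = card S\<close> inequalities are then added up.
\<close>

lemma power_mult_sum_le_card_mult_prod:
  fixes x :: "'a \<Rightarrow> real"
  assumes "finite S" "0 \<le> a" "\<And>i. i \<in> S \<Longrightarrow> a \<le> x i"
  shows "a ^ (card S - 1) * (\<Sum>i\<in>S. x i) \<le> real (card S) * (\<Prod>i\<in>S. x i)"
proof -
  have "a ^ (card S - 1) * x i \<le> (\<Prod>i\<in>S. x i)" if "i \<in> S" for i
  proof -
    have "(\<Prod>j\<in>S - {i}. a) \<le> (\<Prod>j\<in>S - {i}. x j)"
      by (rule prod_mono) (use assms in auto)
    then have "x i * a ^ (card S - 1) \<le> x i * (\<Prod>j\<in>S - {i}. x j)"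
      using assms that by (intro mult_left_mono) (auto intro: order_trans)
    then show ?thesis
      using assms(1) that by (simp add: prod.remove[of S i] mult.commute)
  qed
  then have "(\<Sum>i\<in>S. a ^ (card S - 1) * x i) \<le> (\<Sum>i\<in>S. \<Prod>i\<in>S. x i)"
    by (rule sum_mono)
  then show ?thesis
    by (simp add: sum_distrib_left)
qed

lemma card_mult_prod_le_power_mult_sum:
  fixes x :: "'a \<Rightarrow> real"
  assumes "finite S" "\<And>i. i \<in> S \<Longrightarrow> 0 \<le> x i" "\<And>i. i \<in> S \<Longrightarrow> x i \<le> b"
  shows "real (card S) * (\<Prod>i\<in>S. x i) \<le> b ^ (card S - 1) * (\<Sum>i\<in>S. x i)"
proof -
  have "(\<Prod>i\<in>S. x i) \<le> b ^ (card S - 1) * x i" if "i \<in> S" for i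
  proof -
    have "(\<Prod>j\<in>S - {i}. x j) \<le> (\<Prod>j\<in>S - {i}. b)"
      by (rule prod_mono) (use assms in auto)
    then have "x i * (\<Prod>j\<in>S - {i}. x j) \<le> x i * b ^ (card S - 1)"
      using assms that by (intro mult_left_mono) auto
    then show ?thesis
      using assms(1) that by (simp add: prod.remove[of S i] mult.commute)
  qed
  then have "(\<Sum>i\<in>S. \<Prod>i\<in>S. x i) \<le> (\<Sum>i\<in>S. b ^ (card S - 1) * x i)"
    by (rule sum_mono)
  then show ?thesis
    by (simp add: sum_distrib_left)
qed

lemma power_powr_inverse:
  fixes m :: real
  assumes "p \<ge> 2" "m > 0"
  shows "(m ^ (p - 1)) powr (1 / (real p - 1)) = m"
  using assms by (simp add: powr_powr of_nat_diff flip: powr_realpow)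

lemma prod_sum_pos:
  fixes x :: "nat \<Rightarrow> real"
  assumes "p \<ge> 2" "\<And>i. i < p \<Longrightarrow> x i > 0"
  shows "(\<Prod>i<p. x i) > 0" "(\<Sum>i<p. x i) > 0"
  using assms by (auto intro!: prod_pos sum_pos simp: lessThan_empty_iff)

lemma beta_mean_between:
  assumes "p \<ge> 2" "0 < a" "\<And>i. i < p \<Longrightarrow> a \<le> x i" "\<And>i. i < p \<Longrightarrow> x i \<le> b"
  shows "a \<le> beta_mean p x" "beta_mean p x \<le> b"
proof -
  have x_pos: "x i > 0" if "i < p" for i
    using assms(2,3) that by force
  have b_pos: "b > 0"
    using x_pos[of 0] assms(4)[of 0] assms(1) by simp
  note pos = prod_sum_pos[of p x, OF assms(1) x_pos]
  let ?Q = "real p * (\<Prod>i<p. x i) / (\<Sum>i<p. x i)"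
  have "a ^ (p - 1) \<le> ?Q"
    using power_mult_sum_le_card_mult_prod[of "{..<p}" a x] assms pos
    by (simp add: pos_le_divide_eq)
  then have "(a ^ (p - 1)) powr (1 / (real p - 1)) \<le> ?Q powr (1 / (real p - 1))"
    using assms by (intro powr_mono2) auto
  then show "a \<le> beta_mean p x"
    by (simp only: power_powr_inverse[OF assms(1,2)] beta_mean_def)
  have "?Q \<le> b ^ (p - 1)"
    using card_mult_prod_le_power_mult_sum[of "{..<p}" x b] assms x_pos pos
    by (simp add: pos_divide_le_eq less_imp_le)
  then have "?Q powr (1 / (real p - 1)) \<le> (b ^ (p - 1)) powr (1 / (real p - 1))"
    using assms pos by (intro powr_mono2) auto
  then show "beta_mean p x \<le> b"
    by (simp only: power_powr_inverse[OF assms(1) b_pos] beta_mean_def)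
qed

lemma comp_one_rest_geom_mean:
  assumes "p \<ge> 1"
  shows "comp_one_rest p (geom_mean p) K M x = (K x * M x ^ (p - 1)) powr (1 / real p)"
proof -
  obtain n where n: "p = Suc n"
    using assms by (cases p) auto
  have "(\<Prod>i<p. if i = 0 then K x else M x) = K x * M x ^ (p - 1)"
    by (simp add: n prod.lessThan_Suc_shift del: prod.lessThan_Suc)
  then show ?thesis
    by (simp add: comp_one_rest_def geom_mean_def)
qed

lemma powr_base_eq_iff:
  fixes u v c :: real
  assumes "u > 0" "v > 0" "c \<noteq> 0"
  shows "u powr c = v powr c \<longleftrightarrow> u = v"
  using assms by (auto simp: powr_def)

text \<open>
  At a fixed point the invariance equation is an equation in the one unknown \<open>M x > 0\<close>, and the
  Beta-type mean is its only positive solution.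
\<close>

lemma invariance_iff_beta_mean:
  assumes "p \<ge> 2" "\<And>i. i < p \<Longrightarrow> x i > 0" "M x > 0"
  shows "comp_one_rest p (geom_mean p) (arith_mean p) M x = geom_mean p x
           \<longleftrightarrow> M x = beta_mean p x"
proof -
  let ?P = "\<Prod>i<p. x i" and ?S = "\<Sum>i<p. x i"
  let ?Q = "real p * ?P / ?S"
  note pos = prod_sum_pos[of p x, OF assms(1,2)]
  have "comp_one_rest p (geom_mean p) (arith_mean p) M x = geom_mean p x
          \<longleftrightarrow> arith_mean p x * M x ^ (p - 1) = ?P"
    using assms pos
    by (simp add: comp_one_rest_geom_mean geom_mean_def powr_base_eq_iff arith_mean_def)
  also have "\<dots> \<longleftrightarrow> M x ^ (p - 1) = ?Q"
    using assms(1) pos by (auto simp: arith_mean_def field_simps)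
  also have "\<dots> \<longleftrightarrow> (M x ^ (p - 1)) powr (1 / (real p - 1)) = ?Q powr (1 / (real p - 1))"
    using assms pos by (intro powr_base_eq_iff[symmetric]) auto
  also have "\<dots> \<longleftrightarrow> M x = beta_mean p x"
    by (simp only: power_powr_inverse[OF assms(1,3)] beta_mean_def)
  finally show ?thesis .
qed

lemma is_mean_beta_mean:
  assumes "p \<ge> 2" "is_interval I" "I \<subseteq> {0<..}"
  shows "is_mean p I (restrict (beta_mean p) (cart_power I p))"
proof -
  have "beta_mean p x \<in> I \<and> Min (x ` {..<p}) \<le> beta_mean p x \<and> beta_mean p x \<le> Max (x ` {..<p})"
    if x: "x \<in> cart_power I p" for x
  proof -
    let ?a = "Min (x ` {..<p})" and ?b = "Max (x ` {..<p})"
    have coords: "x ` {..<p} \<subseteq> I"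
      using x by (auto simp: cart_power_def)
    have "x ` {..<p} \<noteq> {}"
      using assms(1) by (auto simp: lessThan_empty_iff)
    then have ends: "?a \<in> I" "?b \<in> I"
      using coords by (meson Max_in Min_in finite_imageI finite_lessThan subsetD)+
    moreover have "?a \<le> beta_mean p x" "beta_mean p x \<le> ?b"
      using assms ends beta_mean_between[of p ?a x ?b] by auto
    ultimately show ?thesis
      using mem_is_interval_1_I[OF assms(2)] by blast
  qed
  then show ?thesis
    by (simp add: is_mean_def)
qed

theorem lemma1:
  fixes p :: nat and I :: "real set"
  assumes "p \<ge> 2"
    and "is_interval I"
    and "I \<subseteq> {0<..}"
  shows "(\<exists>!M. is_mean p I M \<and>
            (\<forall>x \<in> cart_power I p.
               comp_one_rest p (geom_mean p) (arith_mean p) M x = geom_mean p x)) \<and>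
         (\<forall>M. is_mean p I M \<and>
            (\<forall>x \<in> cart_power I p.
               comp_one_rest p (geom_mean p) (arith_mean p) M x = geom_mean p x)
            \<longrightarrow> M = restrict (beta_mean p) (cart_power I p))"
proof -
  let ?B = "restrict (beta_mean p) (cart_power I p)"
  have eq_iff: "comp_one_rest p (geom_mean p) (arith_mean p) M x = geom_mean p x
                  \<longleftrightarrow> M x = beta_mean p x"
    if "is_mean p I M" "x \<in> cart_power I p" for M x
  proof (rule invariance_iff_beta_mean[OF assms(1)])
    show "x i > 0" if "i < p" for i
      using \<open>x \<in> cart_power I p\<close> that assms(3) by (auto simp: cart_power_def)
    have "M x \<in> I"
      using that by (auto simp: is_mean_def)
    then show "M x > 0"
      using assms(3) by auto
  qed
  have B_mean: "is_mean p I ?B"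
    using assms by (rule is_mean_beta_mean)
  have unique: "M = ?B"
    if "is_mean p I M"
      "\<forall>x \<in> cart_power I p. comp_one_rest p (geom_mean p) (arith_mean p) M x = geom_mean p x"
    for M
  proof (rule extensionalityI)
    show "M \<in> extensional (cart_power I p)"
      using that(1) by (auto simp: is_mean_def PiE_def)
    show "M x = ?B x" if "x \<in> cart_power I p" for x
      using that eq_iff \<open>is_mean p I M\<close>
        \<open>\<forall>x \<in> cart_power I p. comp_one_rest p (geom_mean p) (arith_mean p) M x = geom_mean p x\<close>
      by auto
  qed auto
  have "\<forall>x \<in> cart_power I p. comp_one_rest p (geom_mean p) (arith_mean p) ?B x = geom_mean p x"
    using eq_iff[OF B_mean] by simp
  with B_mean unique show ?thesis
    by blast
qed

end
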